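(* Let $P=(L,\ell_0,G,\ell_\mathrm{err})$ and $P'=(L',\ell'_0,G',\ell'_\mathrm{err})$ be deterministic CFAs. Whenever Algorithm DD (described in the context), run on input $(P,P')$, returns a tuple $(N,E,n_0,\Delta)$ (for any order of removing elements from its waitlist), this tuple is a difference graph for $P$ and $P'$.
   Context: Programs operate on variables; a concrete data state $c$ assigns a value to every variable. $Ops$ is a set of operations, each either an assignment or an assume operation. An assume operation $op$ is a predicate on data states (write $c\models op$); $op$ is satisfiable if some data state satisfies it; for assume operations, $op'\Rightarrow op$ means every data state satisfying $op'$ satisfies $op$, and $op_1\equiv\neg op_2$ means $op_1$ holds exactly in the data states where $op_2$ does not. For an assignment $op$, $SP_{op}(c)$ denotes the data state after executing $op$ in $c$. $wr(op)$ is the set of variables whose value $op$ may change. $rd(op)$ is a set of variables such that whenever $c,c'$ agree on $rd(op)$, then for an assume $op$: $c\models op\iff c'\models op$, and for an assignment $op$: $SP_{op}(c)$ and $SP_{op}(c')$ agree on $wr(op)$. A CFA $P=(L,\ell_0,G,\ell_\mathrm{err})$ consists of locations $L$, initial location $\ell_0\in L$, error location $\ell_\mathrm{err}\in L$, and edges $G\subseteq L\times Ops\times L$. $P$ is deterministic if for all $(\ell,op_1,\ell_1),(\ell,op_2,\ell_2)\in G$ either $op_1=op_2$ and $\ell_1=\ell_2$, or $op_1,op_2$ are assume operations with $op_1\equiv\neg op_2$. An executable path of $P$ is a sequence $(\ell_0,c_0)\xrightarrow{g_1}(\ell_1,c_1)\cdots\xrightarrow{g_n}(\ell_n,c_n)$,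 $n\ge0$, with arbitrary $c_0$, $g_i=(\ell_{i-1},op_i,\ell_i)\in G$, and: if $op_i$ is an assume then $c_{i-1}\models op_i$ and $c_i=c_{i-1}$; if $op_i$ is an assignment then $c_i=SP_{op_i}(c_{i-1})$. $paths^\mathrm{err}(P)$: executable paths visiting $\ell_\mathrm{err}$. For original $P$ and modified $P'$, $paths^\mathrm{rb}(P,P')$ is the set of $\pi'\in paths^\mathrm{err}(P')$ such that no $\pi\in paths^\mathrm{err}(P)$ has the same initial data state as $\pi'$. A difference graph for $P,P'$ is a tuple $(N,E,n_0,\Delta)$ with nodes $N$, initial node $n_0\in N$, $\Delta\subseteq N$, $E\subseteq N\times G'\times N$, such that for every $\pi'=(\ell'_0,c'_0)\xrightarrow{g'_1}\cdots\xrightarrow{g'_n}(\ell'_n,c'_n)\in paths^\mathrm{rb}(P,P')$, every $0\le k\le n$ and every sequence $n_0\xrightarrow{g'_1}n_1\cdots\xrightarrow{g'_k}n_k$ with $(n_{i-1},g'_i,n_i)\in E$, there is a sequence of $E$-edges $n_k\to\cdots\to n_{k+m}$ ($m\ge0$) with $n_{k+m}\in\Delta$. Algorithm DD (input: deterministic CFAs $P,P'$). Nodes are either pairs in $L\times L'$ or single locations in $L'$ (treated as distinct kinds). It maintains sets $waitlist,visited\subseteq L\times L'$, $\Delta\subseteq L'$, a set $edges$ of triples $(p,g',s)$ with $p\in L\times L'$, $g'\in G'$, $s\in(L\times L')\cup L'$, and a map $modif$ from $L\times L'$ to sets of variables. Initially $waitlist=visited=\{(\ell_0,\ell'_0)\}$,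 $edges=\Delta=\emptyset$, $modif(x)=\emptyset$ for all $x$. Subroutine PROCESS$(p,g',s,V)$: (a) if $s\in L'$: add $s$ to $\Delta$, add $(p,g',s)$ to $edges$, and remove from $visited$ and from $waitlist$ every pair with second component $s$. (b) Otherwise $s=(\ell,\ell')$. If $\ell\ne\ell_\mathrm{err}$ and $\ell'=\ell'_\mathrm{err}$, call PROCESS$(p,g',\ell'_\mathrm{err},\emptyset)$. Otherwise: if $\ell'\notin\Delta$, $\ell\ne\ell_\mathrm{err}$ and ($s\notin visited$ or $V\not\subseteq modif(s)$), add $s$ to $waitlist$; then if $\ell'\notin\Delta$, add $s$ to $visited$ and set $modif(s):=modif(s)\cup V$; finally add $(p,g',s)$ to $edges$. Main loop: while $waitlist\ne\emptyset$, remove some $(\ell_1,\ell'_1)$ from $waitlist$; for each $g'=(\ell'_1,op',\ell'_2)\in G'$, with $M$ the current value of $modif((\ell_1,\ell'_1))$: (1) if $op'$ is an assignment: if some $(\ell_1,op',\ell_2)\in G$ exists, let $V=M\cup wr(op')$ if $M\cap rd(op')\ne\emptyset$ and $V=M\setminus wr(op')$ otherwise, and call PROCESS$((\ell_1,\ell'_1),g',(\ell_2,\ell'_2),V)$; otherwise call PROCESS$((\ell_1,\ell'_1),g',(\ell_1,\ell'_2),M\cup wr(op'))$. (2) if $op'$ is an assume: set $\ell_p:=\ell_1$, $V:=M$; while $\ell_p\ne\ell_\mathrm{err}$ and some $(\ell_p,op_a,\ell_s)\in G$ with $op_a$ an assignment exists, set $\ell_p:=\ell_s$ and $V:=V\cup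 wr(op_a)$. Then, if $\ell_p\ne\ell_\mathrm{err}$ and some $(\ell_p,op,\ell_2)\in G$ exists with $op=op'$ or ($op'\Rightarrow op$ and $op'$ satisfiable): if $V\cap(rd(op)\cup rd(op'))\ne\emptyset$ call PROCESS$((\ell_1,\ell'_1),g',\ell'_2,\emptyset)$, else call PROCESS$((\ell_1,\ell'_1),g',(\ell_2,\ell'_2),V)$; otherwise call PROCESS$((\ell_1,\ell'_1),g',(\ell_p,\ell'_2),V)$. After the loop: if $\ell'_0\in\Delta$, or $\ell'_0=\ell'_\mathrm{err}$ and $\ell_0\ne\ell_\mathrm{err}$, return $(\{\ell'_0\},\emptyset,\ell'_0,\{\ell'_0\})$. Otherwise return $(visited\cup\Delta,E,(\ell_0,\ell'_0),\Delta)$ where $E$ is the set of $(n,g',n')$ with $n\in visited$, $g'\in G'$, $n'\in visited\cup\Delta$, such that $(n,g',n')\in edges$, or $n'\in\Delta$ and $(n,g',(\ell,n'))\in edges$ for some $\ell\in L$. *)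

theory Defs
  imports Main
begin

section \<open>Operations\<close>

type_synonym ('v, 'd) data_state = "'v \<Rightarrow> 'd"

datatype ('v, 'd) semantics =
    Assume "('v, 'd) data_state \<Rightarrow> bool"
  | Assign "('v, 'd) data_state \<Rightarrow> ('v, 'd) data_state"

text \<open>
  The type \<open>'op\<close> is the set of operations. Operations are kept apart from their semantics, since
  the algorithm compares operations by identity. The set \<open>wr op\<close> contains every variable whose
  value \<open>op\<close> may change; it may contain further variables (for instance \<open>x\<close> for the
  assignment of \<open>x\<close> to itself).
\<close>

locale operations =
  fixes sem :: "'op \<Rightarrow> ('v, 'd) semantics"
    and rd :: "'op \<Rightarrow> 'v set"
    and wr :: "'op \<Rightarrow> 'v set"
  assumes wr_Assign: "sem op = Assign f \<Longrightarrow> v \<notin> wr op \<Longrightarrow> f c v = c v"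
    and rd_Assume: "sem op = Assume b \<Longrightarrow> (\<And>v. v \<in> rd op \<Longrightarrow> c v = c' v) \<Longrightarrow> b c \<longleftrightarrow> b c'"
    and rd_Assign: "sem op = Assign f \<Longrightarrow> (\<And>v. v \<in> rd op \<Longrightarrow> c v = c' v) \<Longrightarrow>
      w \<in> wr op \<Longrightarrow> f c w = f c' w"
begin

definition is_assume :: "'op \<Rightarrow> bool" where
  "is_assume op \<longleftrightarrow> (\<exists>b. sem op = Assume b)"

definition is_assign :: "'op \<Rightarrow> bool" where
  "is_assign op \<longleftrightarrow> (\<exists>f. sem op = Assign f)"

definition satisfiable :: "'op \<Rightarrow> bool" where
  "satisfiable op \<longleftrightarrow> (\<exists>b c. sem op = Assume b \<and> b c)"

definition op_implies :: "'op \<Rightarrow> 'op \<Rightarrow> bool" where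
  "op_implies op1 op2 \<longleftrightarrow>
    (\<exists>b1 b2. sem op1 = Assume b1 \<and> sem op2 = Assume b2 \<and> (\<forall>c. b1 c \<longrightarrow> b2 c))"

definition op_negates :: "'op \<Rightarrow> 'op \<Rightarrow> bool" where
  "op_negates op1 op2 \<longleftrightarrow>
    (\<exists>b1 b2. sem op1 = Assume b1 \<and> sem op2 = Assume b2 \<and> (\<forall>c. b1 c \<longleftrightarrow> \<not> b2 c))"

definition op_step :: "'op \<Rightarrow> ('v, 'd) data_state \<Rightarrow> ('v, 'd) data_state \<Rightarrow> bool" where
  "op_step op c c' \<longleftrightarrow>
    (case sem op of Assume b \<Rightarrow> b c \<and> c' = c | Assign f \<Rightarrow> c' = f c)"

end


section \<open>Control-flow automata and executable paths\<close>

type_synonym ('l, 'op) edge = "'l \<times> 'op \<times> 'l"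

record ('l, 'op) cfa =
  locs :: "'l set"
  init_loc :: 'l
  cfa_edges :: "('l, 'op) edge set"
  err_loc :: 'l

definition is_cfa :: "('l, 'op) cfa \<Rightarrow> bool" where
  "is_cfa P \<longleftrightarrow> init_loc P \<in> locs P \<and> err_loc P \<in> locs P \<and>
     cfa_edges P \<subseteq> locs P \<times> UNIV \<times> locs P"

text \<open>
  The pair \<open>(cs, gs)\<close> stands for the path with configurations \<open>cs ! 0, \<dots>, cs ! n\<close> and edges
  \<open>gs ! 0, \<dots>, gs ! (n - 1)\<close>, where \<open>n = length gs\<close> and \<open>gs ! i\<close> leads from \<open>cs ! i\<close> to
  \<open>cs ! Suc i\<close>.
\<close>

type_synonym ('l, 'op, 'v, 'd) path = "('l \<times> ('v, 'd) data_state) list \<times> ('l, 'op) edge list"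

context operations
begin

definition deterministic :: "('l, 'op) cfa \<Rightarrow> bool" where
  "deterministic P \<longleftrightarrow>
    (\<forall>l op1 l1 op2 l2. (l, op1, l1) \<in> cfa_edges P \<longrightarrow> (l, op2, l2) \<in> cfa_edges P \<longrightarrow>
       op1 = op2 \<and> l1 = l2 \<or> op_negates op1 op2)"

definition exec_paths :: "('l, 'op) cfa \<Rightarrow> ('l, 'op, 'v, 'd) path set" where
  "exec_paths P = {(cs, gs).
     length cs = Suc (length gs) \<and> fst (cs ! 0) = init_loc P \<and>
     (\<forall>i < length gs. gs ! i \<in> cfa_edges P \<and>
        (\<exists>op. gs ! i = (fst (cs ! i), op, fst (cs ! Suc i)) \<and>
              op_step op (snd (cs ! i)) (snd (cs ! Suc i))))}"

definition paths_err :: "('l, 'op) cfa \<Rightarrow> ('l, 'op, 'v, 'd) path set" where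
  "paths_err P = {(cs, gs) \<in> exec_paths P. \<exists>i < length cs. fst (cs ! i) = err_loc P}"

definition paths_rb :: "('l, 'op) cfa \<Rightarrow> ('m, 'op) cfa \<Rightarrow> ('m, 'op, 'v, 'd) path set" where
  "paths_rb P P' = {(cs', gs') \<in> paths_err P'.
     \<not> (\<exists>(cs, gs) \<in> paths_err P. snd (cs ! 0) = snd (cs' ! 0))}"

end


section \<open>Difference graphs\<close>

type_synonym ('n, 'g) diff_graph = "'n set \<times> ('n \<times> 'g \<times> 'n) set \<times> 'n \<times> 'n set"

context operations
begin

definition is_difference_graph ::
  "('l, 'op) cfa \<Rightarrow> ('m, 'op) cfa \<Rightarrow> ('n, ('m, 'op) edge) diff_graph \<Rightarrow> bool" where
  "is_difference_graph P P' = (\<lambda>(N, E, n0, D).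
     n0 \<in> N \<and> D \<subseteq> N \<and> E \<subseteq> N \<times> cfa_edges P' \<times> N \<and>
     (\<forall>(cs', gs') \<in> paths_rb P P'. \<forall>k \<le> length gs'. \<forall>ns.
        length ns = Suc k \<and> ns ! 0 = n0 \<and> (\<forall>i < k. (ns ! i, gs' ! i, ns ! Suc i) \<in> E) \<longrightarrow>
        (\<exists>d \<in> D. (ns ! k, d) \<in> {(n, n'). \<exists>g'. (n, g', n') \<in> E}\<^sup>*)))"

end


section \<open>The algorithm\<close>

text \<open>A node \<open>Inl (l, l')\<close> is a pair of locations, a node \<open>Inr l'\<close> a single location of the
  modified program.\<close>

type_synonym ('l, 'm) node = "('l \<times> 'm) + 'm"

record ('l, 'm, 'op, 'v) dd_state =
  waitlist :: "('l \<times> 'm) set"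
  visited :: "('l \<times> 'm) set"
  delta :: "'m set"
  dd_edges :: "(('l \<times> 'm) \<times> ('m, 'op) edge \<times> ('l, 'm) node) set"
  modif :: "'l \<times> 'm \<Rightarrow> 'v set"

definition dd_init :: "('l, 'op) cfa \<Rightarrow> ('m, 'op) cfa \<Rightarrow> ('l, 'm, 'op, 'v) dd_state" where
  "dd_init P P' =
    \<lparr>waitlist = {(init_loc P, init_loc P')}, visited = {(init_loc P, init_loc P')},
     delta = {}, dd_edges = {}, modif = (\<lambda>_. {})\<rparr>"

definition process_single ::
  "'l \<times> 'm \<Rightarrow> ('m, 'op) edge \<Rightarrow> 'm \<Rightarrow> ('l, 'm, 'op, 'v) dd_state \<Rightarrow> ('l, 'm, 'op, 'v) dd_state"
  where
  "process_single p g' l' \<sigma> = \<sigma>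
    \<lparr>delta := insert l' (delta \<sigma>),
     dd_edges := insert (p, g', Inr l') (dd_edges \<sigma>),
     visited := {x \<in> visited \<sigma>. snd x \<noteq> l'},
     waitlist := {x \<in> waitlist \<sigma>. snd x \<noteq> l'}\<rparr>"

definition process_pair ::
  "('l, 'op) cfa \<Rightarrow> ('m, 'op) cfa \<Rightarrow> 'l \<times> 'm \<Rightarrow> ('m, 'op) edge \<Rightarrow> 'l \<times> 'm \<Rightarrow> 'v set \<Rightarrow>
   ('l, 'm, 'op, 'v) dd_state \<Rightarrow> ('l, 'm, 'op, 'v) dd_state" where
  "process_pair P P' p g' s V \<sigma> =
    (if fst s \<noteq> err_loc P \<and> snd s = err_loc P' then process_single p g' (err_loc P') \<sigma>
     else
       let \<sigma>1 = (if snd s \<notin> delta \<sigma> \<and> fst s \<noteq> err_loc P \<and>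
                    (s \<notin> visited \<sigma> \<or> \<not> V \<subseteq> modif \<sigma> s)
                  then \<sigma>\<lparr>waitlist := insert s (waitlist \<sigma>)\<rparr> else \<sigma>);
           \<sigma>2 = (if snd s \<notin> delta \<sigma>1
                  then \<sigma>1\<lparr>visited := insert s (visited \<sigma>1),
                           modif := (modif \<sigma>1)(s := modif \<sigma>1 s \<union> V)\<rparr> else \<sigma>1)
       in \<sigma>2\<lparr>dd_edges := insert (p, g', Inl s) (dd_edges \<sigma>2)\<rparr>)"

definition process ::
  "('l, 'op) cfa \<Rightarrow> ('m, 'op) cfa \<Rightarrow> 'l \<times> 'm \<Rightarrow> ('m, 'op) edge \<Rightarrow> ('l, 'm) node \<Rightarrow> 'v set \<Rightarrow>
   ('l, 'm, 'op, 'v) dd_state \<Rightarrow> ('l, 'm, 'op, 'v) dd_state" where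
  "process P P' p g' s V \<sigma> =
    (case s of Inl q \<Rightarrow> process_pair P P' p g' q V \<sigma> | Inr l' \<Rightarrow> process_single p g' l' \<sigma>)"

context operations
begin

text \<open>\<open>skip_assigns P l V lp W\<close>: the inner while loop, started with location \<open>l\<close> and variable
  set \<open>V\<close>, terminates with location \<open>lp\<close> and variable set \<open>W\<close>.\<close>

inductive skip_assigns :: "('l, 'op) cfa \<Rightarrow> 'l \<Rightarrow> 'v set \<Rightarrow> 'l \<Rightarrow> 'v set \<Rightarrow> bool" for P where
  skip_exit: "l = err_loc P \<or> \<not> (\<exists>op ls. (l, op, ls) \<in> cfa_edges P \<and> is_assign op) \<Longrightarrow>
    skip_assigns P l V l V"
| skip_step: "l \<noteq> err_loc P \<Longrightarrow> (l, op, ls) \<in> cfa_edges P \<Longrightarrow> is_assign op \<Longrightarrow>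
    skip_assigns P ls (V \<union> wr op) lp W \<Longrightarrow> skip_assigns P l V lp W"

text \<open>\<open>matching_assume P op' l op l2\<close>: from \<open>l\<close>, the original program has an edge with an
  operation \<open>op\<close> that is \<open>op'\<close> itself or is implied by the satisfiable \<open>op'\<close>.\<close>

definition matching_assume :: "('l, 'op) cfa \<Rightarrow> 'op \<Rightarrow> 'l \<Rightarrow> 'op \<Rightarrow> 'l \<Rightarrow> bool" where
  "matching_assume P op' l op l2 \<longleftrightarrow> l \<noteq> err_loc P \<and> (l, op, l2) \<in> cfa_edges P \<and>
     (op = op' \<or> op_implies op' op \<and> satisfiable op')"

text \<open>\<open>handle_edge P P' p g' \<sigma> \<sigma>'\<close>: the body of the for-each loop, run for the pair \<open>p\<close> and its
  outgoing edge \<open>g'\<close>, can transform \<open>\<sigma>\<close> into \<open>\<sigma>'\<close>.\<close>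

inductive handle_edge ::
  "('l, 'op) cfa \<Rightarrow> ('m, 'op) cfa \<Rightarrow> 'l \<times> 'm \<Rightarrow> ('m, 'op) edge \<Rightarrow>
   ('l, 'm, 'op, 'v) dd_state \<Rightarrow> ('l, 'm, 'op, 'v) dd_state \<Rightarrow> bool" for P P' where
  assign_same: "is_assign op' \<Longrightarrow> (l1, op', l2) \<in> cfa_edges P \<Longrightarrow>
    M = modif \<sigma> (l1, l1') \<Longrightarrow>
    V = (if M \<inter> rd op' \<noteq> {} then M \<union> wr op' else M - wr op') \<Longrightarrow>
    handle_edge P P' (l1, l1') (l1', op', l2') \<sigma>
      (process P P' (l1, l1') (l1', op', l2') (Inl (l2, l2')) V \<sigma>)"
| assign_other: "is_assign op' \<Longrightarrow> \<not> (\<exists>l2. (l1, op', l2) \<in> cfa_edges P) \<Longrightarrow>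
    M = modif \<sigma> (l1, l1') \<Longrightarrow>
    handle_edge P P' (l1, l1') (l1', op', l2') \<sigma>
      (process P P' (l1, l1') (l1', op', l2') (Inl (l1, l2')) (M \<union> wr op') \<sigma>)"
| assume_affected: "is_assume op' \<Longrightarrow> skip_assigns P l1 (modif \<sigma> (l1, l1')) lp V \<Longrightarrow>
    matching_assume P op' lp op l2 \<Longrightarrow> V \<inter> (rd op \<union> rd op') \<noteq> {} \<Longrightarrow>
    handle_edge P P' (l1, l1') (l1', op', l2') \<sigma>
      (process P P' (l1, l1') (l1', op', l2') (Inr l2') {} \<sigma>)"
| assume_same: "is_assume op' \<Longrightarrow> skip_assigns P l1 (modif \<sigma> (l1, l1')) lp V \<Longrightarrow>
    matching_assume P op' lp op l2 \<Longrightarrow> V \<inter> (rd op \<union> rd op') = {} \<Longrightarrow>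
    handle_edge P P' (l1, l1') (l1', op', l2') \<sigma>
      (process P P' (l1, l1') (l1', op', l2') (Inl (l2, l2')) V \<sigma>)"
| assume_other: "is_assume op' \<Longrightarrow> skip_assigns P l1 (modif \<sigma> (l1, l1')) lp V \<Longrightarrow>
    \<not> (\<exists>op l2. matching_assume P op' lp op l2) \<Longrightarrow>
    handle_edge P P' (l1, l1') (l1', op', l2') \<sigma>
      (process P P' (l1, l1') (l1', op', l2') (Inl (lp, l2')) V \<sigma>)"

inductive handle_edges ::
  "('l, 'op) cfa \<Rightarrow> ('m, 'op) cfa \<Rightarrow> 'l \<times> 'm \<Rightarrow> ('m, 'op) edge list \<Rightarrow>
   ('l, 'm, 'op, 'v) dd_state \<Rightarrow> ('l, 'm, 'op, 'v) dd_state \<Rightarrow> bool" for P P' p where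
  "handle_edges P P' p [] \<sigma> \<sigma>"
| "handle_edge P P' p g' \<sigma> \<sigma>' \<Longrightarrow> handle_edges P P' p gs' \<sigma>' \<sigma>'' \<Longrightarrow>
   handle_edges P P' p (g' # gs') \<sigma> \<sigma>''"

text \<open>One iteration of the main loop. The removed pair and the order \<open>gs'\<close> in which its outgoing
  edges are handled are arbitrary.\<close>

inductive dd_step ::
  "('l, 'op) cfa \<Rightarrow> ('m, 'op) cfa \<Rightarrow>
   ('l, 'm, 'op, 'v) dd_state \<Rightarrow> ('l, 'm, 'op, 'v) dd_state \<Rightarrow> bool" for P P' where
  "p \<in> waitlist \<sigma> \<Longrightarrow> distinct gs' \<Longrightarrow> set gs' = {g' \<in> cfa_edges P'. fst g' = snd p} \<Longrightarrow>
   handle_edges P P' p gs' (\<sigma>\<lparr>waitlist := waitlist \<sigma> - {p}\<rparr>) \<sigma>' \<Longrightarrow>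
   dd_step P P' \<sigma> \<sigma>'"

definition dd_result ::
  "('l, 'op) cfa \<Rightarrow> ('m, 'op) cfa \<Rightarrow> ('l, 'm, 'op, 'v) dd_state \<Rightarrow>
   (('l, 'm) node, ('m, 'op) edge) diff_graph" where
  "dd_result P P' \<sigma> =
    (if init_loc P' \<in> delta \<sigma> \<or> init_loc P' = err_loc P' \<and> init_loc P \<noteq> err_loc P
     then ({Inr (init_loc P')}, {}, Inr (init_loc P'), {Inr (init_loc P')})
     else
       (Inl ` visited \<sigma> \<union> Inr ` delta \<sigma>,
        {(Inl p, g', n') | p g' n'.
           p \<in> visited \<sigma> \<and> g' \<in> cfa_edges P' \<and> n' \<in> Inl ` visited \<sigma> \<union> Inr ` delta \<sigma> \<and>
           ((p, g', n') \<in> dd_edges \<sigma> \<or>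
            (\<exists>d \<in> delta \<sigma>. n' = Inr d \<and> (\<exists>l \<in> locs P. (p, g', Inl (l, d)) \<in> dd_edges \<sigma>)))},
        Inl (init_loc P, init_loc P'),
        Inr ` delta \<sigma>))"

text \<open>Some run of the algorithm terminates and returns \<open>out\<close>.\<close>

definition dd_returns ::
  "('l, 'op) cfa \<Rightarrow> ('m, 'op) cfa \<Rightarrow> (('l, 'm) node, ('m, 'op) edge) diff_graph \<Rightarrow> bool" where
  "dd_returns P P' out \<longleftrightarrow>
    (\<exists>\<sigma>. (dd_step P P')\<^sup>*\<^sup>* (dd_init P P') \<sigma> \<and> waitlist \<sigma> = {} \<and> out = dd_result P P' \<sigma>)"

end

end

theory Submission
  imports Defs
begin

text \<open>
  When the algorithm stops, \<open>modif\<close> is a post-fixpoint of the transfer function along every edge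
  between pairs. Hence, along any sequence of \<open>E\<close>-edges through pairs that is labelled by an
  execution of the modified program, the original program has an execution from the same initial
  data state that reaches the first component of the current pair and whose data state differs from
  that of the modified program at most on \<open>modif\<close> of the pair. For a regression-bug path the first
  component is therefore never the error location; so the pair has been expanded, and the path can be
  followed by a further \<open>E\<close>-edge. A visited pair whose second component is the error location has
  the error location as its first component, too, so the path must enter \<open>\<Delta>\<close> before.
\<close>

locale dd_programs = operations sem rd wr
  for sem :: "'op \<Rightarrow> ('v, 'd) semantics" and rd wr :: "'op \<Rightarrow> 'v set" +
  fixes P :: "('l, 'op) cfa" and P' :: "('m, 'op) cfa"
  assumes cfa_P: "is_cfa P" and det_P: "deterministic P"
begin

section \<open>Consequences of determinism of the original program\<close>

lemma not_assign_and_assume: "is_assign op \<Longrightarrow> is_assume op \<Longrightarrow> False"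
  by (auto simp: is_assign_def is_assume_def)

lemma det_assign:
  assumes "(l, op1, l1) \<in> cfa_edges P" "(l, op2, l2) \<in> cfa_edges P" "is_assign op1"
  shows "op1 = op2 \<and> l1 = l2"
  using assms det_P unfolding deterministic_def op_negates_def is_assign_def by fastforce

lemma edge_target_in_locs: "(l, op, l2) \<in> cfa_edges P \<Longrightarrow> l2 \<in> locs P"
  using cfa_P by (auto simp: is_cfa_def)

text \<open>Distinct targets would need operations negating each other. If both are
  \<open>op'\<close>, that operation would negate itself; otherwise \<open>op'\<close> is
  satisfiable and a data state satisfying it satisfies both.\<close>

lemma matching_assume_unique:
  assumes "matching_assume P op' l op1 l1" "matching_assume P op' l op2 l2"
  shows "l1 = l2"
proof (rule ccontr)
  assume "l1 \<noteq> l2"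
  then have "op_negates op1 op2"
    using assms det_P unfolding matching_assume_def deterministic_def by blast
  then obtain b1 b2 where b: "sem op1 = Assume b1" "sem op2 = Assume b2" "\<And>c. b1 c \<longleftrightarrow> \<not> b2 c"
    by (auto simp: op_negates_def)
  have m: "op1 = op' \<or> op_implies op' op1 \<and> satisfiable op'"
    "op2 = op' \<or> op_implies op' op2 \<and> satisfiable op'"
    using assms by (auto simp: matching_assume_def)
  then show False
    using b by (auto simp: op_implies_def satisfiable_def)
qed

text \<open>An assignment edge is the only edge leaving its location, so the variable sets do not
  influence the walk. The two runs may start with different sets because \<open>modif\<close> grows
  between visits to a pair.\<close>

lemma skip_assigns_unique:
  "skip_assigns P l V lp W \<Longrightarrow> skip_assigns P l V2 lp2 W2 \<Longrightarrow> lp = lp2"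
proof (induction arbitrary: V2 rule: skip_assigns.induct)
  case (skip_exit l V)
  from skip_exit(2,1) show ?case by cases auto
next
  case (skip_step l op ls V lp W)
  from skip_step.prems show ?case
  proof cases
    case skip_exit
    then show ?thesis using skip_step.hyps by blast
  next
    case (skip_step op2 ls2)
    then have "ls2 = ls" using det_assign skip_step.hyps \<open>is_assign op\<close> \<open>(l, op, ls) \<in> _\<close> by blast
    then show ?thesis using skip_step skip_step.IH \<open>\<And>V2. _ \<Longrightarrow> lp = lp2\<close> by blast
  qed
qed

lemma skip_assigns_in_locs: "skip_assigns P l V lp W \<Longrightarrow> l \<in> locs P \<Longrightarrow> lp \<in> locs P"
  by (induction rule: skip_assigns.induct) (auto dest: edge_target_in_locs)

section \<open>Executions of the original program as reachability\<close>

text \<open>\<open>paths_rb\<close> depends on an original path only through its initial data state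
  and its reaching the error location, so the lists of \<open>exec_paths\<close> can be traded for a
  closure.\<close>

inductive conf_step :: "'l \<times> ('v, 'd) data_state \<Rightarrow> 'l \<times> ('v, 'd) data_state \<Rightarrow> bool" where
  "(l, op, l2) \<in> cfa_edges P \<Longrightarrow> op_step op c c2 \<Longrightarrow> conf_step (l, c) (l2, c2)"

lemma conf_steps_imp_exec_path:
  assumes "conf_step\<^sup>*\<^sup>* (init_loc P, c0) (l, c)"
  shows "\<exists>cs gs. (cs, gs) \<in> exec_paths P \<and> snd (cs ! 0) = c0 \<and> cs ! length gs = (l, c)"
  using assms
proof (induction "(l, c)" arbitrary: l c rule: rtranclp_induct)
  case base
  have "([(init_loc P, c0)], []) \<in> exec_paths P" by (simp add: exec_paths_def)
  then show ?case by fastforce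
next
  case (step y)
  obtain l1 c1 where y: "y = (l1, c1)" by force
  from step(3)[OF y] obtain cs gs where IH: "(cs, gs) \<in> exec_paths P" "snd (cs ! 0) = c0"
    "cs ! length gs = (l1, c1)" by blast
  from step(2) y obtain op where op: "(l1, op, l) \<in> cfa_edges P" "op_step op c1 c"
    by (auto elim: conf_step.cases)
  have len: "length cs = Suc (length gs)" using IH by (simp add: exec_paths_def)
  have "(cs @ [(l, c)], gs @ [(l1, op, l)]) \<in> exec_paths P"
    using IH op len by (auto simp: exec_paths_def nth_append less_Suc_eq)
  moreover have "snd ((cs @ [(l, c)]) ! 0) = c0" using IH len by (simp add: nth_append)
  moreover have "(cs @ [(l, c)]) ! length (gs @ [(l1, op, l)]) = (l, c)"
    using len by (simp add: nth_append)
  ultimately show ?case by blast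
qed

lemma conf_steps_err_imp_paths_err:
  assumes "conf_step\<^sup>*\<^sup>* (init_loc P, c0) (err_loc P, c)"
  shows "\<exists>(cs, gs) \<in> paths_err P. snd (cs ! 0) = c0"
proof -
  obtain cs gs where "(cs, gs) \<in> exec_paths P" "snd (cs ! 0) = c0" "cs ! length gs = (err_loc P, c)"
    using conf_steps_imp_exec_path[OF assms] by blast
  moreover from this have "length gs < length cs" by (simp add: exec_paths_def)
  ultimately have "(cs, gs) \<in> paths_err P" "snd (cs ! 0) = c0"
    unfolding paths_err_def by (auto intro: exI[of _ "length gs"])
  then show ?thesis by blast
qed

section \<open>Data states that differ at most on a set of variables\<close>

definition agree_off :: "'v set \<Rightarrow> ('v, 'd) data_state \<Rightarrow> ('v, 'd) data_state \<Rightarrow> bool" where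
  "agree_off V c c' \<longleftrightarrow> (\<forall>v. v \<notin> V \<longrightarrow> c v = c' v)"

lemma agree_off_mono: "agree_off V c c' \<Longrightarrow> V \<subseteq> W \<Longrightarrow> agree_off W c c'"
  by (auto simp: agree_off_def)

lemma agree_off_left_assign: "agree_off V c c' \<Longrightarrow> sem op = Assign f \<Longrightarrow> agree_off (V \<union> wr op) (f c) c'"
  by (auto simp: agree_off_def wr_Assign)

lemma agree_off_right_assign: "agree_off V c c' \<Longrightarrow> sem op = Assign f \<Longrightarrow> agree_off (V \<union> wr op) c (f c')"
  by (auto simp: agree_off_def wr_Assign)

text \<open>If the variables read agree, both executions write equal values, which removes
  \<open>wr op\<close> from the possible differences; otherwise the written variables may differ as
  well.\<close>

lemma agree_off_both_assign:
  assumes "agree_off V c c'" "sem op = Assign f"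
  shows "agree_off (if V \<inter> rd op \<noteq> {} then V \<union> wr op else V - wr op) (f c) (f c')"
proof (cases "V \<inter> rd op = {}")
  case True
  then have "\<And>v. v \<in> rd op \<Longrightarrow> c v = c' v" using assms(1) by (auto simp: agree_off_def)
  then have "\<And>w. w \<in> wr op \<Longrightarrow> f c w = f c' w" using rd_Assign[OF assms(2)] by blast
  then have "agree_off (V - wr op) (f c) (f c')"
    using assms wr_Assign[OF assms(2)] unfolding agree_off_def by (metis DiffI)
  with True show ?thesis by simp
qed (use assms in \<open>auto simp: agree_off_def wr_Assign\<close>)

text \<open>Only the original program moves. Assignments can always be executed, and each one adds
  its written variables to the possible differences.\<close>

lemma skip_assigns_sound:
  "skip_assigns P l V lp W \<Longrightarrow> agree_off V c c' \<Longrightarrow>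
    \<exists>c2. conf_step\<^sup>*\<^sup>* (l, c) (lp, c2) \<and> agree_off W c2 c'"
proof (induction arbitrary: c rule: skip_assigns.induct)
  case (skip_step l op ls V lp W)
  from \<open>is_assign op\<close> obtain f where f: "sem op = Assign f" by (auto simp: is_assign_def)
  then have "conf_step (l, c) (ls, f c)"
    using skip_step.hyps by (auto intro!: conf_step.intros simp: op_step_def)
  moreover obtain c2 where "conf_step\<^sup>*\<^sup>* (ls, f c) (lp, c2)" "agree_off W c2 c'"
    using skip_step.IH agree_off_left_assign[OF skip_step.prems f] by blast
  ultimately show ?case by (meson converse_rtranclp_into_rtranclp)
qed blast

text \<open>The state \<open>c'\<close> satisfies \<open>op'\<close>, hence \<open>op\<close>; since
  \<open>c\<close> agrees with \<open>c'\<close> on \<open>rd op\<close>, the assumption transfers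
  to \<open>c\<close>.\<close>

lemma matching_assume_sound:
  assumes "matching_assume P op' l op l2" "op_step op' c' c''" "is_assume op'"
    "agree_off V c c'" "V \<inter> (rd op \<union> rd op') = {}"
  shows "conf_step (l, c) (l2, c)"
proof -
  from assms(3) obtain b' where b': "sem op' = Assume b'" by (auto simp: is_assume_def)
  then obtain b where b: "sem op = Assume b" "\<And>c. b' c \<Longrightarrow> b c"
    using assms(1) by (auto simp: matching_assume_def op_implies_def)
  have "b c'" using assms(2) b b' by (simp add: op_step_def)
  moreover have "\<And>v. v \<in> rd op \<Longrightarrow> c v = c' v" using assms(4,5) by (auto simp: agree_off_def)
  ultimately have "b c" using rd_Assume[OF b(1)] by blast
  then show ?thesis
    using assms(1) b by (auto intro!: conf_step.intros[where op = op]
        simp: op_step_def matching_assume_def)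
qed


section \<open>Transfer function of the algorithm\<close>

text \<open>\<open>dd_succ p g' M n V\<close>: for \<open>modif p = M\<close>, handling \<open>g'\<close> amounts to the call
  PROCESS\<open>(p, g', n, V)\<close>.\<close>

inductive dd_succ ::
  "'l \<times> 'm \<Rightarrow> ('m, 'op) edge \<Rightarrow> 'v set \<Rightarrow> ('l, 'm) node \<Rightarrow> 'v set \<Rightarrow> bool" where
  assign_same: "is_assign op' \<Longrightarrow> (l1, op', l2) \<in> cfa_edges P \<Longrightarrow>
    dd_succ (l1, l1') (l1', op', l2') M (Inl (l2, l2'))
      (if M \<inter> rd op' \<noteq> {} then M \<union> wr op' else M - wr op')"
| assign_other: "is_assign op' \<Longrightarrow> \<not> (\<exists>l2. (l1, op', l2) \<in> cfa_edges P) \<Longrightarrow>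
    dd_succ (l1, l1') (l1', op', l2') M (Inl (l1, l2')) (M \<union> wr op')"
| assume_affected: "is_assume op' \<Longrightarrow> skip_assigns P l1 M lp V \<Longrightarrow>
    matching_assume P op' lp op l2 \<Longrightarrow> V \<inter> (rd op \<union> rd op') \<noteq> {} \<Longrightarrow>
    dd_succ (l1, l1') (l1', op', l2') M (Inr l2') {}"
| assume_same: "is_assume op' \<Longrightarrow> skip_assigns P l1 M lp V \<Longrightarrow>
    matching_assume P op' lp op l2 \<Longrightarrow> V \<inter> (rd op \<union> rd op') = {} \<Longrightarrow>
    dd_succ (l1, l1') (l1', op', l2') M (Inl (l2, l2')) V"
| assume_other: "is_assume op' \<Longrightarrow> skip_assigns P l1 M lp V \<Longrightarrow>
    \<not> (\<exists>op l2. matching_assume P op' lp op l2) \<Longrightarrow>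
    dd_succ (l1, l1') (l1', op', l2') M (Inl (lp, l2')) V"

lemma handle_edge_imp_dd_succ:
  "handle_edge P P' p g' \<sigma> \<sigma>' \<Longrightarrow>
    \<exists>n V. dd_succ p g' (modif \<sigma> p) n V \<and> \<sigma>' = process P P' p g' n V \<sigma>"
  by (induction rule: handle_edge.induct) (blast intro: dd_succ.intros)+

lemma dd_succ_locs:
  assumes "dd_succ p g' M n V"
  shows "fst g' = snd p" and "n = Inl s \<Longrightarrow> snd s = snd (snd g')"
    and "n = Inr d \<Longrightarrow> d = snd (snd g')"
    and "n = Inl s \<Longrightarrow> fst p \<in> locs P \<Longrightarrow> fst s \<in> locs P"
  using assms
  by (auto elim!: dd_succ.cases dest: edge_target_in_locs skip_assigns_in_locs
      simp: matching_assume_def)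

text \<open>The set \<open>M\<close> decides only whether the target is a pair or a single location,
  never which pair. Hence an edge stored under an earlier value of \<open>modif\<close> can be
  compared with the one for the final value.\<close>

lemma dd_succ_unique:
  assumes "dd_succ p g' M1 (Inl s1) V1" "dd_succ p g' M2 (Inl s2) V2"
  shows "s1 = s2"
  using assms(1)
proof cases
  case (assign_same op' l1 l2 l1' l2')
  from assms(2) show ?thesis unfolding assign_same(1,2)
    by cases (use assign_same det_assign not_assign_and_assume in blast)+
next
  case (assign_other op' l1 l1' l2')
  from assms(2) show ?thesis unfolding assign_other(1,2)
    by cases (use assign_other not_assign_and_assume in blast)+
next
  case (assume_same op' l1 lp op l2 l1' l2')
  from assms(2) show ?thesis unfolding assume_same(1,2)
    by cases (use assume_same not_assign_and_assume skip_assigns_unique matching_assume_unique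
        in blast)+
next
  case (assume_other op' l1 lp l1' l2')
  from assms(2) show ?thesis unfolding assume_other(1,2)
    by cases (use assume_other not_assign_and_assume skip_assigns_unique in blast)+
qed

text \<open>One step of the modified program is answered by zero or more original steps: the same
  assignment, no step, or skipped assignments with or without a matching assume.\<close>

lemma dd_succ_sound:
  assumes "dd_succ p g' M (Inl s) V" "op_step (fst (snd g')) c' c''" "agree_off M c c'"
  shows "\<exists>c2. conf_step\<^sup>*\<^sup>* (fst p, c) (fst s, c2) \<and> agree_off V c2 c''"
  using assms(1)
proof cases
  case (assign_same op' l1 l2 l1' l2')
  then obtain f where f: "sem op' = Assign f" by (auto simp: is_assign_def)
  then have "conf_step (l1, c) (l2, f c)" "c'' = f c'"
    using assms(2) assign_same by (auto intro!: conf_step.intros simp: op_step_def)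
  then show ?thesis using agree_off_both_assign[OF assms(3) f, folded \<open>c'' = f c'\<close>] assign_same
    by (intro exI[of _ "f c"]) simp
next
  case (assign_other op' l1 l1' l2')
  then obtain f where f: "sem op' = Assign f" by (auto simp: is_assign_def)
  then have "c'' = f c'" using assms(2) assign_other by (auto simp: op_step_def)
  then show ?thesis using agree_off_right_assign[OF assms(3) f] assign_other by auto
next
  case (assume_same op' l1 lp op l2 l1' l2')
  obtain c2 where c2: "conf_step\<^sup>*\<^sup>* (l1, c) (lp, c2)" "agree_off V c2 c'"
    using skip_assigns_sound assume_same assms(3) by blast
  have "conf_step (lp, c2) (l2, c2)"
    using matching_assume_sound assume_same c2(2) assms(2) by auto
  then have "conf_step\<^sup>*\<^sup>* (l1, c) (l2, c2)" using c2(1) by simp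
  moreover have "c'' = c'" using assms(2) assume_same by (auto simp: is_assume_def op_step_def)
  ultimately show ?thesis using c2(2) assume_same by auto
next
  case (assume_other op' l1 lp l1' l2')
  moreover have "c'' = c'" using assms(2) assume_other by (auto simp: is_assume_def op_step_def)
  ultimately show ?thesis using skip_assigns_sound assms(3) by auto
qed


section \<open>Invariant of the main loop\<close>

text \<open>\<open>recorded \<sigma> p g' n V\<close>: the effect of PROCESS\<open>(p, g', n, V)\<close> is still present in \<open>\<sigma>\<close>.
  The edge to \<open>Inr (snd s)\<close> stems from the redirection of pairs to the error location.\<close>

definition recorded ::
  "('l, 'm, 'op, 'v) dd_state \<Rightarrow> 'l \<times> 'm \<Rightarrow> ('m, 'op) edge \<Rightarrow> ('l, 'm) node \<Rightarrow> 'v set \<Rightarrow> bool" where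
  "recorded \<sigma> p g' n V \<longleftrightarrow>
    (case n of
       Inr d \<Rightarrow> d \<in> delta \<sigma> \<and> (p, g', Inr d) \<in> dd_edges \<sigma>
     | Inl s \<Rightarrow>
         snd s \<in> delta \<sigma> \<and> ((p, g', Inl s) \<in> dd_edges \<sigma> \<or> (p, g', Inr (snd s)) \<in> dd_edges \<sigma>) \<or>
         s \<in> visited \<sigma> \<and> V \<subseteq> modif \<sigma> s \<and> (p, g', Inl s) \<in> dd_edges \<sigma>)"

text \<open>The successor refers to the current \<open>modif \<sigma> p\<close>. When that set
  grows, the property may fail until \<open>p\<close> is expanded again.\<close>

definition handled :: "('l, 'm, 'op, 'v) dd_state \<Rightarrow> 'l \<times> 'm \<Rightarrow> ('m, 'op) edge \<Rightarrow> bool" where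
  "handled \<sigma> p g' \<longleftrightarrow> (\<exists>n V. dd_succ p g' (modif \<sigma> p) n V \<and> recorded \<sigma> p g' n V)"

text \<open>\<open>X\<close> contains the pairs and edges which the current iteration of the main loop still has to
  handle.\<close>

definition dd_inv ::
  "(('l \<times> 'm) \<times> ('m, 'op) edge) set \<Rightarrow> ('l, 'm, 'op, 'v) dd_state \<Rightarrow> bool" where
  "dd_inv X \<sigma> \<longleftrightarrow>
    (\<forall>q \<in> visited \<sigma> - waitlist \<sigma>. fst q \<noteq> err_loc P \<longrightarrow>
       (\<forall>g' \<in> cfa_edges P'. fst g' = snd q \<longrightarrow> (q, g') \<in> X \<or> handled \<sigma> q g')) \<and>
    (\<forall>q \<in> visited \<sigma>. snd q \<notin> delta \<sigma>) \<and>
    (\<forall>p g' s. (p, g', Inl s) \<in> dd_edges \<sigma> \<longrightarrow> (\<exists>M V. dd_succ p g' M (Inl s) V)) \<and>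
    (\<forall>q \<in> visited \<sigma> \<union> waitlist \<sigma>. fst q \<in> locs P) \<and>
    (\<forall>q \<in> visited \<sigma>. snd q = err_loc P' \<longrightarrow>
       fst q = err_loc P \<or> q = (init_loc P, init_loc P')) \<and>
    ((init_loc P, init_loc P') \<in> visited \<sigma> \<or> init_loc P' \<in> delta \<sigma>)"

text \<open>Stored edges are never deleted, and a pair leaves \<open>visited\<close> only when its
  second component joins \<open>delta\<close>; then the first alternative of \<open>recorded\<close>
  applies.\<close>

lemma recorded_process_single:
  "recorded \<sigma> q h n V \<Longrightarrow> recorded (process_single p g' d \<sigma>) q h n V"
  by (cases n) (auto simp: recorded_def process_single_def)

lemma recorded_process_pair:
  "recorded \<sigma> q h n V \<Longrightarrow> recorded (process_pair P P' p g' s W \<sigma>) q h n V"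
proof (cases "fst s \<noteq> err_loc P \<and> snd s = err_loc P'")
  case True
  then show "recorded \<sigma> q h n V \<Longrightarrow> ?thesis"
    by (simp add: process_pair_def recorded_process_single)
next
  case False
  then show "recorded \<sigma> q h n V \<Longrightarrow> ?thesis"
    by (cases n) (auto simp: recorded_def process_pair_def Let_def)
qed

lemma recorded_process: "recorded \<sigma> q h n V \<Longrightarrow> recorded (process P P' p g' m W \<sigma>) q h n V"
  by (cases m) (auto simp: process_def recorded_process_single recorded_process_pair)

lemma recorded_process_self: "recorded (process P P' p g' n V \<sigma>) p g' n V"
  by (cases n) (auto simp: process_def recorded_def process_pair_def process_single_def Let_def)

text \<open>A call that makes a pair newly visited or enlarges its \<open>modif\<close> also puts it
  on the waitlist, unless its first component is the error location.\<close>

lemma process_pending: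
  assumes "q \<in> visited (process P P' p g' n V \<sigma>) - waitlist (process P P' p g' n V \<sigma>)"
    "fst q \<noteq> err_loc P"
  shows "q \<in> visited \<sigma> - waitlist \<sigma>" "modif (process P P' p g' n V \<sigma>) q = modif \<sigma> q"
  using assms
  by (auto simp: process_def process_pair_def process_single_def Let_def
      split: sum.splits if_splits)

lemma dd_inv_process:
  assumes inv: "dd_inv X \<sigma>" and succ: "dd_succ p g' (modif \<sigma> p) n V" and p: "fst p \<in> locs P"
  shows "dd_inv (X - {(p, g')}) (process P P' p g' n V \<sigma>)" (is "dd_inv _ ?\<sigma>")
proof -
  note inv = inv[unfolded dd_inv_def]
  have "(q, h) \<in> X - {(p, g')} \<or> handled ?\<sigma> q h"
    if q: "q \<in> visited ?\<sigma> - waitlist ?\<sigma>" "fst q \<noteq> err_loc P"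
      and h: "h \<in> cfa_edges P'" "fst h = snd q" for q h
  proof (cases "(q, h) = (p, g')")
    case True
    then show ?thesis
      \<comment> \<open>A self-loop could enlarge \<open>modif\<close> of \<open>p\<close> during
        this very call, but \<open>p\<close> would then be waiting again, contrary to
        \<open>q\<close>. So the successor computed before the call is still the current
        one.\<close>
      using succ process_pending(2)[OF q] recorded_process_self unfolding handled_def
      by (metis prod.inject)
  next
    case False
    have "(q, h) \<in> X \<or> handled \<sigma> q h" using inv process_pending(1)[OF q] q(2) h by blast
    then show ?thesis
      using False process_pending(2)[OF q] by (auto simp: handled_def intro: recorded_process)
  qed
  moreover have "\<exists>M V. dd_succ q h M (Inl s) V" if "(q, h, Inl s) \<in> dd_edges ?\<sigma>" for q h s
  proof -
    have "(q, h, Inl s) \<in> dd_edges \<sigma> \<or> (q, h, Inl s) = (p, g', n)"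
      using that by (auto simp: process_def process_pair_def process_single_def Let_def
          split: sum.splits if_splits)
    then show ?thesis using inv succ by blast
  qed
  moreover have "\<forall>q \<in> visited ?\<sigma>. snd q \<notin> delta ?\<sigma>"
    using inv by (auto simp: process_def process_pair_def process_single_def Let_def
        split: sum.splits if_splits)
  moreover have "\<forall>q \<in> visited ?\<sigma> \<union> waitlist ?\<sigma>. fst q \<in> locs P"
  proof -
    have "visited ?\<sigma> \<union> waitlist ?\<sigma> \<subseteq> visited \<sigma> \<union> waitlist \<sigma> \<union> {s. n = Inl s}"
      by (auto simp: process_def process_pair_def process_single_def Let_def
        split: sum.splits if_splits)
    then show ?thesis using inv dd_succ_locs(4)[OF succ] p by blast
  qed
  moreover have "\<forall>q \<in> visited ?\<sigma>. snd q = err_loc P' \<longrightarrow>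
      fst q = err_loc P \<or> q = (init_loc P, init_loc P')"
  proof -
    \<comment> \<open>Pairs in which only the modified program is at its error location are
      redirected to \<open>process_single\<close> and never become visited here.\<close>
    have "visited ?\<sigma> \<subseteq> visited \<sigma> \<union> {s. fst s = err_loc P \<or> snd s \<noteq> err_loc P'}"
      by (auto simp: process_def process_pair_def process_single_def Let_def
        split: sum.splits if_splits)
    then show ?thesis using inv by blast
  qed
  moreover have "(init_loc P, init_loc P') \<in> visited ?\<sigma> \<or> init_loc P' \<in> delta ?\<sigma>"
    using inv by (auto simp: process_def process_pair_def process_single_def Let_def
        split: sum.splits if_splits)
  ultimately show ?thesis unfolding dd_inv_def by blast
qed

text \<open>An edge back to \<open>p\<close> may change \<open>modif\<close> of \<open>p\<close>
  between two edges. This is harmless: \<open>p\<close> is then waiting again, or is exempt because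
  its first component is the error location.\<close>

lemma dd_inv_handle_edges:
  "handle_edges P P' p gs \<sigma> \<sigma>' \<Longrightarrow> fst p \<in> locs P \<Longrightarrow> dd_inv X \<sigma> \<Longrightarrow>
    dd_inv (X - {p} \<times> set gs) \<sigma>'"
proof (induction arbitrary: X rule: handle_edges.induct)
  case (2 g' \<sigma> \<sigma>' gs' \<sigma>'')
  obtain n V where "dd_succ p g' (modif \<sigma> p) n V" "\<sigma>' = process P P' p g' n V \<sigma>"
    using handle_edge_imp_dd_succ[OF 2(1)] by blast
  then have "dd_inv (X - {(p, g')}) \<sigma>'" using dd_inv_process 2 by blast
  then have "dd_inv (X - {(p, g')} - {p} \<times> set gs') \<sigma>''" using 2 by blast
  moreover have "X - {(p, g')} - {p} \<times> set gs' = X - {p} \<times> set (g' # gs')" by auto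
  ultimately show ?case by simp
qed simp

lemma dd_inv_dd_step:
  assumes "dd_step P P' \<sigma> \<sigma>'" "dd_inv {} \<sigma>"
  shows "dd_inv {} \<sigma>'"
  using assms(1)
proof cases
  case (1 p gs')
  have "handled (\<sigma>\<lparr>waitlist := w\<rparr>) q g' = handled \<sigma> q g'" for w q g'
    by (simp add: handled_def recorded_def cong: sum.case_cong)
  \<comment> \<open>Off the waitlist, \<open>p\<close> falls under the first conjunct of the
    invariant; \<open>X\<close> excuses exactly its outgoing edges.\<close>
  then have "dd_inv ({p} \<times> set gs') (\<sigma>\<lparr>waitlist := waitlist \<sigma> - {p}\<rparr>)"
    using assms(2) 1(3) unfolding dd_inv_def by auto
  moreover have "fst p \<in> locs P" using assms(2) 1(1) by (auto simp: dd_inv_def)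
  ultimately have "dd_inv ({p} \<times> set gs' - {p} \<times> set gs') \<sigma>'"
    using dd_inv_handle_edges[OF 1(4)] by blast
  then show ?thesis by simp
qed

lemma dd_inv_reachable:
  assumes "(dd_step P P')\<^sup>*\<^sup>* (dd_init P P') \<sigma>"
  shows "dd_inv {} \<sigma>"
  using assms
proof (induction rule: rtranclp_induct)
  case base
  then show ?case using cfa_P by (auto simp: dd_inv_def dd_init_def is_cfa_def)
qed (rule dd_inv_dd_step)


section \<open>The final state yields a difference graph\<close>

lemma exec_path_step:
  assumes "(cs', gs') \<in> exec_paths P'" "i < length gs'"
  shows "gs' ! i \<in> cfa_edges P'" "fst (gs' ! i) = fst (cs' ! i)"
    "snd (snd (gs' ! i)) = fst (cs' ! Suc i)"
    "op_step (fst (snd (gs' ! i))) (snd (cs' ! i)) (snd (cs' ! Suc i))"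
  using assms by (fastforce simp: exec_paths_def)+

definition simulates ::
  "('l, 'm, 'op, 'v) dd_state \<Rightarrow> ('v, 'd) data_state \<Rightarrow> 'l \<times> 'm \<Rightarrow> 'm \<times> ('v, 'd) data_state \<Rightarrow> bool"
  where
  "simulates \<sigma> c0 p x \<longleftrightarrow> p \<in> visited \<sigma> \<and> snd p = fst x \<and>
    (\<exists>c. conf_step\<^sup>*\<^sup>* (init_loc P, c0) (fst p, c) \<and> agree_off (modif \<sigma> p) c (snd x))"

lemma dd_result_is_difference_graph:
  assumes inv: "dd_inv {} \<sigma>" and fin: "waitlist \<sigma> = {}"
  shows "is_difference_graph P P' (dd_result P P' \<sigma>)"
proof (cases "init_loc P' \<in> delta \<sigma> \<or> init_loc P' = err_loc P' \<and> init_loc P \<noteq> err_loc P")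
  case True
  then have "dd_result P P' \<sigma> =
      ({Inr (init_loc P')}, {}, Inr (init_loc P'), {Inr (init_loc P')})"
    by (simp add: dd_result_def)
  then show ?thesis by (auto simp: is_difference_graph_def)
next
  case False
  define E :: "(('l, 'm) node \<times> ('m, 'op) edge \<times> ('l, 'm) node) set"
    where "E = {(Inl p, g', n') | p g' n'.
           p \<in> visited \<sigma> \<and> g' \<in> cfa_edges P' \<and> n' \<in> Inl ` visited \<sigma> \<union> Inr ` delta \<sigma> \<and>
           ((p, g', n') \<in> dd_edges \<sigma> \<or>
            (\<exists>d \<in> delta \<sigma>. n' = Inr d \<and> (\<exists>l \<in> locs P. (p, g', Inl (l, d)) \<in> dd_edges \<sigma>)))}"
  let ?n0 = "Inl (init_loc P, init_loc P') :: ('l, 'm) node"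
  let ?R = "{(n, n'). \<exists>g'. (n, g', n') \<in> E}"
  have res: "dd_result P P' \<sigma> = (Inl ` visited \<sigma> \<union> Inr ` delta \<sigma>, E, ?n0, Inr ` delta \<sigma>)"
    using False unfolding dd_result_def E_def by simp
  note inv = inv[unfolded dd_inv_def]
  have init: "(init_loc P, init_loc P') \<in> visited \<sigma>" using inv False by blast
  \<comment> \<open>Redirected edges in \<open>E\<close> require the original location to lie in
    \<open>locs P\<close>, which is why the invariant tracks membership in
    \<open>locs P\<close>.\<close>
  have E_I: "(Inl p, g', n) \<in> E"
    if "p \<in> visited \<sigma>" "g' \<in> cfa_edges P'" "n \<in> Inl ` visited \<sigma> \<union> Inr ` delta \<sigma>"
      "(p, g', n) \<in> dd_edges \<sigma> \<or>
        (\<exists>s. n = Inr (snd s) \<and> snd s \<in> delta \<sigma> \<and> fst s \<in> locs P \<and> (p, g', Inl s) \<in> dd_edges \<sigma>)"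
    for p g' n
    using that unfolding E_def by fastforce
  have "\<exists>d \<in> Inr ` delta \<sigma>. (ns ! k, d) \<in> ?R\<^sup>*"
    if rb: "(cs', gs') \<in> paths_rb P P'" and k: "k \<le> length gs'"
      and ns: "length ns = Suc k" "ns ! 0 = ?n0" "\<forall>i < k. (ns ! i, gs' ! i, ns ! Suc i) \<in> E"
    for cs' gs' k ns
  proof -
    define c0 where "c0 = snd (cs' ! 0)"
    have exec: "(cs', gs') \<in> exec_paths P'" and
      len: "length cs' = Suc (length gs')" and start: "fst (cs' ! 0) = init_loc P'"
      using rb by (auto simp: paths_rb_def paths_err_def exec_paths_def)
    obtain j where j: "j \<le> length gs'" "fst (cs' ! j) = err_loc P'"
      using rb len by (auto simp: paths_rb_def paths_err_def less_Suc_eq_le)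
    have no_err: "\<not> conf_step\<^sup>*\<^sup>* (init_loc P, c0) (err_loc P, c)" for c
      using conf_steps_err_imp_paths_err[of c0 c] rb by (auto simp: paths_rb_def c0_def)
    have sim_no_err: "fst p \<noteq> err_loc P \<and> snd p \<noteq> err_loc P'" if "simulates \<sigma> c0 p x" for p x
    proof -
      have "fst p \<noteq> err_loc P" using that no_err by (auto simp: simulates_def)
      moreover have "p \<in> visited \<sigma>" using that by (simp add: simulates_def)
      \<comment> \<open>By the invariant, only the initial pair could still have the error location
        as second component; the assumption \<open>False\<close> rules it out.\<close>
      ultimately show ?thesis using inv False by auto
    qed
    have sim_step: "simulates \<sigma> c0 s (cs' ! Suc i)"
      if sim: "simulates \<sigma> c0 p (cs' ! i)" and i: "i < length gs'"
        and e: "(Inl p, gs' ! i, Inl s) \<in> E" for p s i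
    proof -
      from e have e': "p \<in> visited \<sigma>" "s \<in> visited \<sigma>" "(p, gs' ! i, Inl s) \<in> dd_edges \<sigma>"
        by (auto simp: E_def)
      then have "snd s \<notin> delta \<sigma>" using inv by blast
      \<comment> \<open>\<open>M\<close> is some possibly outdated value of \<open>modif\<close>; it
        serves only to identify the target of the edge.\<close>
      obtain M V where succ: "dd_succ p (gs' ! i) M (Inl s) V" using inv e'(3) by blast
      have "handled \<sigma> p (gs' ! i)"
        using inv e'(1) fin sim_no_err[OF sim] e dd_succ_locs(1)[OF succ]
        by (auto simp: E_def)
      then obtain n W where n: "dd_succ p (gs' ! i) (modif \<sigma> p) n W" "recorded \<sigma> p (gs' ! i) n W"
        by (auto simp: handled_def)
      \<comment> \<open>For the final \<open>modif\<close> the target cannot have become a single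
        location, as that would put \<open>snd s\<close> into \<open>delta\<close> although
        \<open>s\<close> is visited.\<close>
      have "n = Inl s"
      proof (cases n)
        case (Inl s')
        then show ?thesis using dd_succ_unique n(1) succ by blast
      next
        case (Inr d)
        then have "d = snd s" using dd_succ_locs(2)[OF succ] dd_succ_locs(3)[OF n(1)] by simp
        then show ?thesis using n(2) Inr \<open>snd s \<notin> delta \<sigma>\<close> by (simp add: recorded_def)
      qed
      then have W: "W \<subseteq> modif \<sigma> s" using n(2) \<open>snd s \<notin> delta \<sigma>\<close> by (simp add: recorded_def)
      obtain c where c: "conf_step\<^sup>*\<^sup>* (init_loc P, c0) (fst p, c)"
        "agree_off (modif \<sigma> p) c (snd (cs' ! i))"
        using sim by (auto simp: simulates_def)
      obtain c2 where "conf_step\<^sup>*\<^sup>* (fst p, c) (fst s, c2)" "agree_off W c2 (snd (cs' ! Suc i))"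
        using dd_succ_sound n(1) \<open>n = Inl s\<close> exec_path_step(4)[OF exec i] c(2) by blast
      then show ?thesis
        using c(1) e'(2) W agree_off_mono dd_succ_locs(2)[OF succ] exec_path_step(3)[OF exec i]
        unfolding simulates_def by (metis rtranclp_trans)
    qed
    \<comment> \<open>Since \<open>fst p\<close> is not the error location, \<open>p\<close> has
      been expanded along \<open>gs' ! i\<close>. The stored target is either a visited pair or has
      its location in \<open>delta\<close>, and each case gives an edge of \<open>E\<close>.\<close>
    have progress: "(\<exists>d \<in> delta \<sigma>. (Inl p, gs' ! i, Inr d) \<in> E) \<or> (\<exists>s. (Inl p, gs' ! i, Inl s) \<in> E)"
      if sim: "simulates \<sigma> c0 p (cs' ! i)" and i: "i < length gs'" for p i
    proof -
      have p: "p \<in> visited \<sigma>" "snd p = fst (cs' ! i)" using sim by (auto simp: simulates_def)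
      have g: "gs' ! i \<in> cfa_edges P'" "fst (gs' ! i) = snd p"
        using exec_path_step(1,2)[OF exec i] p by auto
      then have "handled \<sigma> p (gs' ! i)" using inv p fin sim_no_err[OF sim] by auto
      then obtain n W where n: "dd_succ p (gs' ! i) (modif \<sigma> p) n W" "recorded \<sigma> p (gs' ! i) n W"
        by (auto simp: handled_def)
      have "fst p \<in> locs P" using inv p by blast
      show ?thesis
      proof (cases n)
        case (Inl s)
        then have "fst s \<in> locs P" using dd_succ_locs(4)[OF n(1)] \<open>fst p \<in> locs P\<close> by blast
        then show ?thesis
          using n(2) p g Inl E_I[of p "gs' ! i" "Inl s"] E_I[of p "gs' ! i" "Inr (snd s)"]
          by (cases s) (auto simp: recorded_def)
      next
        case (Inr d)
        then show ?thesis using n(2) p g E_I[of p "gs' ! i" n] by (auto simp: recorded_def)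
      qed
    qed
    have finish: "\<exists>d \<in> Inr ` delta \<sigma>. (Inl p, d) \<in> ?R\<^sup>*"
      if "i \<le> j" "simulates \<sigma> c0 p (cs' ! i)" for i p
      using that
    proof (induction arbitrary: p rule: inc_induct)
      \<comment> \<open>The induction descends from \<open>j\<close>, where the path is at the error
        location; no simulating pair exists there, so \<open>delta\<close> must be entered
        earlier.\<close>
      case base
      then show ?case using sim_no_err[OF base] j(2) by (simp add: simulates_def)
    next
      case (step i)
      then have i: "i < length gs'" using j(1) by simp
      from progress[OF step.prems i] show ?case
      proof
        assume "\<exists>d \<in> delta \<sigma>. (Inl p, gs' ! i, Inr d) \<in> E"
        then show ?thesis by blast
      next
        assume "\<exists>s. (Inl p, gs' ! i, Inl s) \<in> E"
        then obtain s where s: "(Inl p, gs' ! i, Inl s) \<in> E" by blast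
        then obtain d where "d \<in> Inr ` delta \<sigma>" "(Inl s, d) \<in> ?R\<^sup>*"
          using step.IH sim_step[OF step.prems i s] by blast
        moreover have "(Inl p, Inl s) \<in> ?R" using s by blast
        ultimately show ?thesis by (meson converse_rtrancl_into_rtrancl)
      qed
    qed
    have sim_ns: "i \<le> k \<Longrightarrow> ns ! i = Inl p \<Longrightarrow> simulates \<sigma> c0 p (cs' ! i)" for i p
    proof (induction i arbitrary: p)
      case 0
      \<comment> \<open>Both programs start in \<open>c0\<close>, so the states agree off any set,
        whatever \<open>modif\<close> of the initial pair has become.\<close>
      then show ?case
        using ns(2) init start by (auto simp: simulates_def c0_def agree_off_def)
    next
      case (Suc i)
      have e: "(ns ! i, gs' ! i, ns ! Suc i) \<in> E" using ns(3) Suc.prems(1) by simp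
      then obtain q where q: "ns ! i = Inl q" by (auto simp: E_def)
      then show ?case using Suc sim_step e k by auto
    qed
    show ?thesis
    proof (cases "ns ! k")
      case (Inr d)
      with ns(2) have "k \<noteq> 0" by (metis sum.distinct(1))
      then have "(ns ! (k - 1), gs' ! (k - 1), ns ! k) \<in> E"
        using ns(3)[rule_format, of "k - 1"] by simp
      then have "d \<in> delta \<sigma>" using Inr by (auto simp: E_def)
      then show ?thesis using Inr by blast
    next
      case (Inl p)
      \<comment> \<open>Edges of \<open>E\<close> leave only pairs, so a sequence going beyond
        \<open>j\<close> would have a simulating pair at the error location.\<close>
      have "k \<le> j"
      proof (rule ccontr)
        assume "\<not> k \<le> j"
        then have "(ns ! j, gs' ! j, ns ! Suc j) \<in> E" using ns(3) by simp
        then obtain q where "ns ! j = Inl q" by (auto simp: E_def)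
        then have sim: "simulates \<sigma> c0 q (cs' ! j)" using sim_ns \<open>\<not> k \<le> j\<close> by simp
        then show False using sim_no_err[OF sim] j(2) by (simp add: simulates_def)
      qed
      then show ?thesis using finish sim_ns Inl by simp
    qed
  qed
  moreover have "E \<subseteq> (Inl ` visited \<sigma> \<union> Inr ` delta \<sigma>) \<times> cfa_edges P' \<times>
      (Inl ` visited \<sigma> \<union> Inr ` delta \<sigma>)"
    by (auto simp: E_def)
  ultimately show ?thesis
    unfolding res is_difference_graph_def using init by blast
qed

end

theorem theorem2:
  fixes sem :: "'op \<Rightarrow> ('v, 'd) semantics"
    and rd wr :: "'op \<Rightarrow> 'v set"
    and P :: "('l, 'op) cfa" and P' :: "('m, 'op) cfa"
  assumes "operations sem rd wr"
    and "is_cfa P" and "is_cfa P'"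
    and "operations.deterministic sem P" and "operations.deterministic sem P'"
    and "operations.dd_returns sem rd wr P P' (N, E, n0, D)"
  shows "operations.is_difference_graph sem P P' (N, E, n0, D)"
proof -
  interpret operations sem rd wr by (rule assms(1))
  interpret dd_programs sem rd wr P P' by unfold_locales (rule assms(2,4))+
  obtain \<sigma> where "(dd_step P P')\<^sup>*\<^sup>* (dd_init P P') \<sigma>" "waitlist \<sigma> = {}"
    "(N, E, n0, D) = dd_result P P' \<sigma>"
    using assms(6) by (auto simp: dd_returns_def)
  then show ?thesis using dd_result_is_difference_graph dd_inv_reachable by metis
qed

end
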